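(* Let $N\geq 1$ and let $W:[0,\infty)\to\mathbb{R}\cup\{+\infty\}$ be a function such that: (1) $W$ is lower-semicontinuous; (2) the function $w(x):=W(|x|)$ is locally integrable on $\mathbb{R}^N$; (3) $W(r)\to\infty$ as $r\to\infty$. Then the energy $$E(\mu)=\int_{\mathbb{R}^N}\int_{\mathbb{R}^N} W(|x-y|)\,d\mu(x)\,d\mu(y)$$ admits a global minimizer in $\mathcal{P}(\mathbb{R}^N)$; that is, there exists $\mu_0\in\mathcal{P}(\mathbb{R}^N)$ such that $E(\mu_0)\leq E(\mu)$ for all $\mu\in\mathcal{P}(\mathbb{R}^N)$.
   Context: $\mathcal{P}(\mathbb{R}^N)$ denotes the set of Borel probability measures on $\mathbb{R}^N$, and $|\cdot|$ is the Euclidean norm. The hypotheses imply that $W$ is bounded from below, so $E$ is well defined with values in $(-\infty,+\infty]$. *)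

theory Defs
  imports "HOL-Probability.Probability"
begin

text \<open>The filter \<^term>\<open>at x within S\<close> is punctured at \<^term>\<open>x\<close>; this does not
  affect the condition below. At isolated points it holds trivially.\<close>

definition lower_semicontinuous_on :: "'a::topological_space set \<Rightarrow> ('a \<Rightarrow> ereal) \<Rightarrow> bool" where
  "lower_semicontinuous_on S f \<longleftrightarrow> (\<forall>x\<in>S. f x \<le> Liminf (at x within S) f)"

definition locally_integrable :: "('a::euclidean_space \<Rightarrow> ereal) \<Rightarrow> bool" where
  "locally_integrable f \<longleftrightarrow>
     f \<in> borel_measurable lebesgue \<and>
     (\<forall>K. compact K \<longrightarrow> (\<integral>\<^sup>+x\<in>K. e2ennreal \<bar>f x\<bar> \<partial>lebesgue) < \<infinity>)"

text \<open>The Lebesgue integral of an extended-real function, as the integral of the positive part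
  minus that of the negative part (\<^const>\<open>e2ennreal\<close> sends negative values to 0). It is
  meaningful only if one of the two is finite; otherwise it is \<^term>\<open>\<infinity> - \<infinity> = (\<infinity>::ereal)\<close>,
  which does not occur for integrands bounded below on a probability space.\<close>

definition ereal_integral :: "'a measure \<Rightarrow> ('a \<Rightarrow> ereal) \<Rightarrow> ereal" where
  "ereal_integral M f =
     enn2ereal (\<integral>\<^sup>+x. e2ennreal (f x) \<partial>M) - enn2ereal (\<integral>\<^sup>+x. e2ennreal (- f x) \<partial>M)"

definition borel_prob_measures :: "'a::topological_space measure set" where
  "borel_prob_measures = {\<mu>. prob_space \<mu> \<and> sets \<mu> = sets borel}"

definition interaction_energy :: "(real \<Rightarrow> ereal) \<Rightarrow> 'a::real_normed_vector measure \<Rightarrow> ereal" where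
  "interaction_energy W \<mu> =
     ereal_integral \<mu> (\<lambda>y. ereal_integral \<mu> (\<lambda>x. W (norm (x - y))))"

end

theory Submission
  imports Defs
begin

text \<open>
  The proof is the direct method of the calculus of variations. A lower semicontinuous \<open>W\<close> that never
  takes the value \<open>-\<infinity>\<close> and tends to \<open>\<infinity>\<close> is bounded below on the half-line, so after adding a constant
  \<open>C\<close> the energy becomes a double integral of a nonnegative kernel (\<open>interaction_energy_add_const\<close>).
  If every measure has infinite energy, any of them is a minimizer. Otherwise take a minimizing
  sequence. The energy is invariant under translations, and its inner integral cannot exceed the
  energy by much at every point; moving a good point to the origin bounds the integral of \<open>V (norm x)\<close>
  uniformly along the sequence, and coercivity of \<open>V\<close> turns this bound into tightness
  (\<open>pair_energy_translate_with_moment_bound\<close>, \<open>tight_if_coercive_moment_bounded\<close>).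

  Compactness and lower semicontinuity are both read off from random variables. Schoenberg's
  construction of a space-filling curve gives a continuous surjection from the line onto Euclidean
  space that has a Borel right inverse of linear growth. Pushing a tight sequence of measures to the
  line along that right inverse, one may use Helly's selection theorem and Skorohod's representation
  theorem for real distributions; composing with the curve brings the result back. Hence a
  subsequence consists of the laws of random variables that converge pointwise on one probability
  space (\<open>tight_sequence_representation\<close>). On the product of that space with itself, lower
  semicontinuity of the kernel and two applications of Fatou's lemma show that the energy of the
  limit law is at most the limit of the energies (\<open>pair_energy_distr_le_liminf\<close>).
\<close>

section \<open>A space-filling curve with a Borel section\<close>

text \<open>The point of the middle-thirds Cantor set whose ternary expansion has a digit \<open>2\<close> exactly where
  \<open>a\<close> holds.\<close>

definition cantor_value :: "(nat \<Rightarrow> bool) \<Rightarrow> real" where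
  "cantor_value a = (\<Sum>l. 2 * of_bool (a l) / 3 ^ (l + 1))"

text \<open>A continuous function of period \<open>2\<close> that is \<open>0\<close> on \<open>[0, 1/3]\<close> and \<open>1\<close> on \<open>[2/3, 1]\<close>, because \<open>cos\<close>
  is at least \<open>1/2\<close> on \<open>[0, \<pi>/3]\<close> and at most \<open>-1/2\<close> on \<open>[2\<pi>/3, \<pi>]\<close>. It therefore reads off the first
  ternary digit of a point of the Cantor set.\<close>

definition switch :: "real \<Rightarrow> real" where
  "switch t = max 0 (min 1 (1/2 - cos (pi * t)))"

text \<open>The \<open>i\<close>-th coordinate of Schoenberg's curve in dimension \<open>N\<close>: for a point \<open>t\<close> of the Cantor set, the
  ternary digits of \<open>t\<close> at the positions congruent to \<open>i\<close> modulo \<open>N\<close> become the binary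
  digits of the coordinate, with \<open>2\<close> read as \<open>1\<close>.\<close>

definition schoenberg_coord :: "nat \<Rightarrow> nat \<Rightarrow> real \<Rightarrow> real" where
  "schoenberg_coord N i t = (\<Sum>k. switch (3 ^ (N * k + i) * t) / 2 ^ (k + 1))"

text \<open>Since \<open>arccos (cos (pi * t)) / pi\<close> is the distance from \<open>t\<close> to the nearest even integer, this
  function is continuous, equals \<open>m + 1\<close> on \<open>[2 * m, 2 * m + 1]\<close>, and climbs linearly in between. It will
  be the scale of the curve, so that successive periods fill larger and larger cubes.\<close>

definition staircase :: "real \<Rightarrow> real" where
  "staircase t = (t - arccos (cos (pi * t)) / pi) / 2 + 1"

lemma sums_two_thirds_powers: "(\<lambda>l. 2 / 3 ^ (l + 1) :: real) sums 1"
  using sums_mult[OF geometric_sums[of "1/3::real"], of "2/3"] by (simp add: power_divide)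

lemma sums_half_powers: "(\<lambda>l. 1 / 2 ^ (l + 1) :: real) sums 1"
  using sums_mult[OF geometric_sums[of "1/2::real"], of "1/2"] by (simp add: power_divide)

lemma summable_cantor_value: "summable (\<lambda>l. 2 * of_bool (a l) / 3 ^ (l + 1) :: real)"
  by (rule summable_comparison_test'[OF sums_summable[OF sums_two_thirds_powers], of 0]) auto

lemma cantor_value_nonneg: "0 \<le> cantor_value a"
  unfolding cantor_value_def by (intro suminf_nonneg summable_cantor_value) auto

lemma cantor_value_le_1: "cantor_value a \<le> 1"
proof -
  have "cantor_value a \<le> (\<Sum>l. 2 / 3 ^ (l + 1))"
    unfolding cantor_value_def
    by (intro suminf_le summable_cantor_value sums_summable[OF sums_two_thirds_powers])
       (auto simp: divide_right_mono)
  then show ?thesis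
    using sums_unique[OF sums_two_thirds_powers] by simp
qed

lemma cantor_value_shift:
  "3 * cantor_value a = 2 * of_bool (a 0) + cantor_value (\<lambda>l. a (Suc l))"
proof -
  have "cantor_value (\<lambda>l. a (Suc l)) / 3 = (\<Sum>l. 2 * of_bool (a (Suc l)) / 3 ^ (l + 2))"
    unfolding cantor_value_def by (subst suminf_divide[symmetric, OF summable_cantor_value]) (simp add: field_simps)
  also have "\<dots> = cantor_value a - 2 * of_bool (a 0) / 3"
    unfolding cantor_value_def using suminf_split_head[OF summable_cantor_value[of a]] by simp
  finally show ?thesis by (simp add: field_simps)
qed

lemma cos_pi_add_even: "cos (pi * (2 * of_int k + s)) = cos (pi * s)"
proof -
  have "pi * (2 * of_int k + s) = pi * s + 2 * pi * of_int k" by (simp add: algebra_simps)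
  then show ?thesis
    using cos_int_2pin[of k] sin_int_2pin[of k] by (simp add: cos_add)
qed

lemma switch_bounds: "0 \<le> switch t" "switch t \<le> 1"
  by (auto simp: switch_def)

lemma switch_cantor_value: "switch (cantor_value a) = of_bool (a 0)"
proof (cases "a 0")
  case True
  have b: "2/3 \<le> cantor_value a" "cantor_value a \<le> 1"
    using cantor_value_shift[of a] cantor_value_nonneg[of "\<lambda>l. a (Suc l)"] cantor_value_le_1 True by auto
  have "cos (pi * cantor_value a) \<le> cos (pi * (2/3))"
    using b by (intro cos_monotone_0_pi_le) auto
  also have "pi * (2/3) = 2 * (pi / 3)" by simp
  also have "cos (2 * (pi / 3)) = - 1/2"
    by (subst cos_double_cos) (simp add: cos_60 power2_eq_square)
  finally show ?thesis using True by (simp add: switch_def)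
next
  case False
  have b: "0 \<le> cantor_value a" "cantor_value a \<le> 1/3"
    using cantor_value_shift[of a] cantor_value_nonneg[of a] cantor_value_le_1[of "\<lambda>l. a (Suc l)"] False by auto
  have "cos (pi * (1/3)) \<le> cos (pi * cantor_value a)"
    using b by (intro cos_monotone_0_pi_le) auto
  then show ?thesis using False by (simp add: switch_def cos_60)
qed

text \<open>Multiplication by \<open>3 ^ j\<close> drops the first \<open>j\<close> ternary digits up to an integer, and that integer is
  even because all digits are \<open>0\<close> or \<open>2\<close>; functions of period \<open>2\<close> do not see it.\<close>

lemma cantor_value_power_shift:
  "\<exists>k::int. 3 ^ j * cantor_value a = 2 * of_int k + cantor_value (\<lambda>l. a (l + j))"
proof (induction j)
  case 0
  then show ?case by (intro exI[of _ 0]) simp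
next
  case (Suc j)
  then obtain k :: int where k: "3 ^ j * cantor_value a = 2 * of_int k + cantor_value (\<lambda>l. a (l + j))" by blast
  have "3 ^ Suc j * cantor_value a = 6 * of_int k + 3 * cantor_value (\<lambda>l. a (l + j))"
    using k by simp
  also have "\<dots> = 2 * of_int (3 * k + of_bool (a j)) + cantor_value (\<lambda>l. a (l + Suc j))"
    by (subst cantor_value_shift) auto
  finally show ?case by blast
qed

lemma switch_even_add_cantor_value:
  "switch (3 ^ j * (2 * of_int m + cantor_value a)) = of_bool (a j)"
proof -
  obtain k :: int where k: "3 ^ j * cantor_value a = 2 * of_int k + cantor_value (\<lambda>l. a (l + j))"
    using cantor_value_power_shift by blast
  have "3 ^ j * (2 * of_int m + cantor_value a)
      = 2 * of_int (3 ^ j * m + k) + cantor_value (\<lambda>l. a (l + j))"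
    using k by (simp add: algebra_simps)
  then have "switch (3 ^ j * (2 * of_int m + cantor_value a)) = switch (cantor_value (\<lambda>l. a (l + j)))"
    unfolding switch_def by (simp only: cos_pi_add_even)
  then show ?thesis by (simp add: switch_cantor_value)
qed

lemma continuous_on_schoenberg_coord: "continuous_on UNIV (schoenberg_coord N i)"
proof -
  have "uniform_limit UNIV (\<lambda>n t. \<Sum>k<n. switch (3 ^ (N * k + i) * t) / 2 ^ (k + 1))
          (\<lambda>t. \<Sum>k. switch (3 ^ (N * k + i) * t) / 2 ^ (k + 1)) sequentially"
  proof (rule Weierstrass_m_test)
    show "summable (\<lambda>k. 1 / 2 ^ (k + 1) :: real)" by (rule sums_summable[OF sums_half_powers])
  qed (auto intro!: divide_right_mono simp: switch_bounds)
  moreover have "continuous_on UNIV (\<lambda>t. \<Sum>k<n. switch (3 ^ (N * k + i) * t) / 2 ^ (k + 1))" for n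
    unfolding switch_def by (intro continuous_intros) auto
  ultimately have "continuous_on UNIV (\<lambda>t. \<Sum>k. switch (3 ^ (N * k + i) * t) / 2 ^ (k + 1))"
    by (intro uniform_limit_theorem[OF _ _ sequentially_bot] always_eventually) auto
  then show ?thesis by (simp add: schoenberg_coord_def[abs_def])
qed

lemma continuous_on_staircase: "continuous_on UNIV staircase"
  unfolding staircase_def by (intro continuous_intros) auto

lemma staircase_even_add:
  assumes "0 \<le> s" "s \<le> 1"
  shows "staircase (2 * of_int m + s) = of_int m + 1"
proof -
  have "arccos (cos (pi * (2 * of_int m + s))) = pi * s"
    using assms by (simp only: cos_pi_add_even) (simp add: arccos_cos)
  then show ?thesis by (simp add: staircase_def)
qed

text \<open>The partial sums are the dyadic truncations \<open>\<lfloor>2 ^ n * u\<rfloor> / 2 ^ n\<close>, since doubling a number doubles its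
  integer part up to the parity of the new integer part.\<close>

lemma binary_digits_sums:
  fixes u :: real
  assumes "0 \<le> u" "u < 1"
  shows "(\<lambda>k. of_bool (odd \<lfloor>2 ^ (k + 1) * u\<rfloor>) / 2 ^ (k + 1)) sums u"
proof -
  have double: "\<lfloor>2 * x\<rfloor> = 2 * \<lfloor>x\<rfloor> + of_bool (odd \<lfloor>2 * x\<rfloor>)" for x :: real
  proof -
    have "\<lfloor>2 * x\<rfloor> = 2 * \<lfloor>x\<rfloor> \<or> \<lfloor>2 * x\<rfloor> = 2 * \<lfloor>x\<rfloor> + 1" by linarith
    then show ?thesis by auto
  qed
  have partial: "(\<Sum>k<n. of_bool (odd \<lfloor>2 ^ (k + 1) * u\<rfloor>) / 2 ^ (k + 1)) = (of_int \<lfloor>2 ^ n * u\<rfloor> / 2 ^ n :: real)" for n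
  proof (induction n)
    case 0
    have "\<lfloor>u\<rfloor> = 0" using assms by linarith
    then show ?case by simp
  next
    case (Suc n)
    have "real_of_int \<lfloor>2 ^ (n + 1) * u\<rfloor> = 2 * of_int \<lfloor>2 ^ n * u\<rfloor> + of_bool (odd \<lfloor>2 ^ (n + 1) * u\<rfloor>)"
      using arg_cong[OF double[of "2 ^ n * u"], of real_of_int] by (simp add: mult.assoc)
    then show ?case using Suc by (simp add: field_simps)
  qed
  have "(\<lambda>n. of_int \<lfloor>2 ^ n * u\<rfloor> / 2 ^ n) \<longlonglongrightarrow> u"
  proof (rule tendsto_sandwich)
    show "\<forall>\<^sub>F n in sequentially. u - (1/2) ^ n \<le> of_int \<lfloor>2 ^ n * u\<rfloor> / 2 ^ n"
    proof (intro always_eventually allI)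
      fix n
      have "2 ^ n * u - 1 \<le> of_int \<lfloor>2 ^ n * u\<rfloor>" by linarith
      then have "(2 ^ n * u - 1) / 2 ^ n \<le> of_int \<lfloor>2 ^ n * u\<rfloor> / 2 ^ n"
        by (rule divide_right_mono) simp
      then show "u - (1/2) ^ n \<le> of_int \<lfloor>2 ^ n * u\<rfloor> / 2 ^ n"
        by (simp add: diff_divide_distrib power_divide)
    qed
    show "\<forall>\<^sub>F n in sequentially. of_int \<lfloor>2 ^ n * u\<rfloor> / 2 ^ n \<le> u"
    proof (intro always_eventually allI)
      fix n
      have "of_int \<lfloor>2 ^ n * u\<rfloor> \<le> 2 ^ n * u" by linarith
      then show "of_int \<lfloor>2 ^ n * u\<rfloor> / 2 ^ n \<le> u" by (simp add: field_simps)
    qed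
    have "(\<lambda>n. u - (1/2) ^ n) \<longlonglongrightarrow> u - 0"
      by (intro tendsto_diff tendsto_const LIMSEQ_power_zero) simp
    then show "(\<lambda>n. u - (1/2) ^ n) \<longlonglongrightarrow> u" by simp
  qed simp
  then show ?thesis by (simp only: sums_def partial)
qed

text \<open>A point \<open>x\<close> with \<open>m = \<lfloor>norm x\<rfloor>\<close> lies in the open cube of half-width \<open>m + 1\<close>. Rescale that cube to the
  unit cube, interleave the binary digits of the coordinates into one point of the Cantor set, and
  place it in the \<open>m\<close>-th period: this is the section, which is Borel since it is built from floors
  and a series. On that period the curve is Schoenberg's curve scaled back by \<open>m + 1\<close>, so it returns \<open>x\<close>.
  The linear bound on the section is what preserves tightness later on.\<close>

lemma space_filling_curve_with_borel_section:
  obtains \<Psi> :: "real \<Rightarrow> 'a::euclidean_space" and \<phi> :: "'a \<Rightarrow> real"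
  where "continuous_on UNIV \<Psi>" "\<phi> \<in> borel_measurable borel" "\<And>x. \<Psi> (\<phi> x) = x"
    "\<And>x. 0 \<le> \<phi> x" "\<And>x. \<phi> x \<le> 2 * norm x + 1"
proof -
  define N where "N = DIM('a)"
  have N: "N > 0" by (simp add: N_def)
  obtain \<beta> where \<beta>: "bij_betw \<beta> {..<N} (Basis :: 'a set)"
    using ex_bij_betw_nat_finite[of "Basis :: 'a set"] by (auto simp: N_def atLeast0LessThan)
  have \<beta>_Basis: "\<beta> i \<in> Basis" if "i < N" for i
    using \<beta> that by (auto simp: bij_betw_def)
  define u where "u x i = ((x \<bullet> \<beta> i) / (of_int \<lfloor>norm x\<rfloor> + 1) + 1) / 2" for x i
  define a where "a x j = odd \<lfloor>2 ^ (j div N + 1) * u x (j mod N)\<rfloor>" for x j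
  define \<Psi> where "\<Psi> t = staircase t *\<^sub>R (\<Sum>i<N. (2 * schoenberg_coord N i t - 1) *\<^sub>R \<beta> i)" for t
  define \<phi> where "\<phi> x = 2 * of_int \<lfloor>norm x\<rfloor> + cantor_value (a x)" for x
  have coord: "schoenberg_coord N i (\<phi> x) = u x i" if "i < N" for i x
  proof -
    \<comment> \<open>Taking the floor plus one keeps the rescaled coordinate strictly below 1, as binary digits require.\<close>
    have "\<bar>x \<bullet> \<beta> i\<bar> < of_int \<lfloor>norm x\<rfloor> + 1"
      using Basis_le_norm[OF \<beta>_Basis[OF that], of x] by linarith
    then have "0 \<le> u x i" "u x i < 1"
      by (auto simp: u_def field_simps abs_less_iff)
    moreover have "(N * k + i) div N = k" "(N * k + i) mod N = i" for k
      using that by auto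
    ultimately show ?thesis
      using sums_unique[OF binary_digits_sums, of "u x i"]
      by (simp add: schoenberg_coord_def \<phi>_def switch_even_add_cantor_value a_def)
  qed
  show thesis
  proof
    show "continuous_on UNIV \<Psi>"
      unfolding \<Psi>_def
      by (intro continuous_intros continuous_on_staircase continuous_on_schoenberg_coord)
    have odd_meas: "(\<lambda>z::int. of_bool (odd z) :: real) \<in> borel_measurable (count_space UNIV)" by simp
    have [measurable]: "(\<lambda>x. of_bool (a x j) :: real) \<in> borel_measurable borel" for j
      unfolding a_def u_def
      by (rule measurable_compose[OF _ odd_meas]) measurable
    show "\<phi> \<in> borel_measurable borel"
      unfolding \<phi>_def cantor_value_def by measurable
    show "0 \<le> \<phi> x" for x
      using cantor_value_nonneg[of "a x"] by (simp add: \<phi>_def)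
    show "\<phi> x \<le> 2 * norm x + 1" for x
      using cantor_value_le_1[of "a x"] of_int_floor_le[of "norm x"] unfolding \<phi>_def by linarith
    show "\<Psi> (\<phi> x) = x" for x
    proof -
      have pos: "of_int \<lfloor>norm x\<rfloor> + (1::real) > 0" using floor_correct[of "norm x"] norm_ge_zero[of x] by linarith
      have m: "(of_int \<lfloor>norm x\<rfloor> + 1) * (2 * u x i - 1) = x \<bullet> \<beta> i" for i
      proof -
        have "2 * ((z + 1) / 2) - 1 = z" for z :: real by (simp add: field_simps)
        then have "2 * u x i - 1 = (x \<bullet> \<beta> i) / (of_int \<lfloor>norm x\<rfloor> + 1)" unfolding u_def .
        then show ?thesis using pos by simp
      qed
      have "\<Psi> (\<phi> x) = (of_int \<lfloor>norm x\<rfloor> + 1) *\<^sub>R (\<Sum>i<N. (2 * u x i - 1) *\<^sub>R \<beta> i)"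
        by (simp add: \<Psi>_def coord) (simp add: \<phi>_def staircase_even_add cantor_value_nonneg cantor_value_le_1)
      also have "\<dots> = (\<Sum>i<N. (x \<bullet> \<beta> i) *\<^sub>R \<beta> i)"
        by (simp add: scaleR_sum_right m)
      also have "\<dots> = (\<Sum>b\<in>Basis. (x \<bullet> b) *\<^sub>R b)"
        by (rule sum.reindex_bij_betw[OF \<beta>])
      finally show ?thesis by (simp add: euclidean_representation)
    qed
  qed
qed

section \<open>Tight sequences converge almost surely in a suitable representation\<close>

text \<open>Prokhorov's theorem and Skorohod's representation in one statement, reduced to the real line by
  the space-filling curve \<open>\<Psi>\<close> with section \<open>\<phi>\<close>: the laws \<open>\<kappa> n\<close> of \<open>\<phi>\<close> are tight, and \<open>\<nu> n\<close> is the law of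
  \<open>\<Psi>\<close> under \<open>\<kappa> n\<close>. Continuity of \<open>\<Psi>\<close> carries pointwise convergence back from the line.\<close>

lemma tight_sequence_representation:
  fixes \<nu> :: "nat \<Rightarrow> 'a::euclidean_space measure"
  assumes prob: "\<And>n. prob_space (\<nu> n)" and sets: "\<And>n. sets (\<nu> n) = sets borel"
    and tight: "\<forall>\<epsilon>::real>0. \<exists>R. \<forall>n. measure (\<nu> n) {x. R \<le> norm x} < \<epsilon>"
  shows "\<exists>r (\<Omega> :: real measure) X Y. strict_mono r \<and> prob_space \<Omega> \<and>
    (\<forall>n. X n \<in> borel_measurable \<Omega>) \<and> Y \<in> borel_measurable \<Omega> \<and>
    (\<forall>n. distr \<Omega> borel (X n) = \<nu> (r n)) \<and>
    (\<forall>\<omega>\<in>space \<Omega>. (\<lambda>n. X n \<omega>) \<longlonglongrightarrow> Y \<omega>)"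
proof -
  note [measurable_cong] = sets
  obtain \<Psi> :: "real \<Rightarrow> 'a" and \<phi> where cont: "continuous_on UNIV \<Psi>"
    and \<phi>[measurable]: "\<phi> \<in> borel_measurable borel" and \<Psi>\<phi>: "\<And>x. \<Psi> (\<phi> x) = x"
    and \<phi>_bounds: "\<And>x. 0 \<le> \<phi> x" "\<And>x. \<phi> x \<le> 2 * norm x + 1"
    using space_filling_curve_with_borel_section by blast
  have \<Psi>[measurable]: "\<Psi> \<in> borel_measurable borel"
    using cont by (rule borel_measurable_continuous_onI)
  define \<kappa> where "\<kappa> n = distr (\<nu> n) borel \<phi>" for n
  have real_\<kappa>: "real_distribution (\<kappa> n)" for n
    unfolding \<kappa>_def by (intro prob_space.real_distribution_distr prob) measurable
  have space: "space (\<nu> n) = UNIV" for n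
    using sets_eq_imp_space_eq[OF sets] by simp
  have "tight \<kappa>"
    unfolding tight_def
  proof (intro conjI allI impI real_\<kappa>)
    fix \<epsilon> :: real assume "\<epsilon> > 0"
    then obtain R where R: "\<And>n. measure (\<nu> n) {x. R \<le> norm x} < \<epsilon>" using tight by blast
    define b where "b = 2 * \<bar>R\<bar> + 1"
    have "1 - \<epsilon> < measure (\<kappa> n) {-1<..b}" for n
    proof -
      interpret prob_space "\<nu> n" by (rule prob)
      have "1 - \<epsilon> < 1 - measure (\<nu> n) {x. R \<le> norm x}" using R[of n] by simp
      also have "\<dots> = measure (\<nu> n) (space (\<nu> n) - {x. R \<le> norm x})"
        by (intro prob_compl[symmetric]) measurable
      also have "\<dots> \<le> measure (\<nu> n) (\<phi> -` {-1<..b} \<inter> space (\<nu> n))"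
      proof (intro finite_measure_mono subsetI)
        fix x assume "x \<in> space (\<nu> n) - {x. R \<le> norm x}"
        then show "x \<in> \<phi> -` {-1<..b} \<inter> space (\<nu> n)"
          using \<phi>_bounds[of x] by (auto simp: b_def)
      qed measurable
      also have "\<dots> = measure (\<kappa> n) {-1<..b}"
        unfolding \<kappa>_def by (intro measure_distr[symmetric]) auto
      finally show ?thesis .
    qed
    then show "\<exists>a b. a < b \<and> (\<forall>n. 1 - \<epsilon> < measure (\<kappa> n) {a<..b})"
      by (intro exI[of _ "-1"] exI[of _ b]) (auto simp: b_def)
  qed
  from tight_imp_convergent_subsubsequence[OF this strict_mono_id]
  obtain r M where r: "strict_mono r" and M: "real_distribution M"
    and conv: "weak_conv_m (\<kappa> \<circ> r) M" by auto
  have "\<exists>(\<Omega> :: real measure) Z_seq Z. prob_space \<Omega> \<and> (\<forall>n. Z_seq n \<in> borel_measurable \<Omega>) \<and>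
      (\<forall>n. distr \<Omega> borel (Z_seq n) = (\<kappa> \<circ> r) n) \<and> Z \<in> measurable \<Omega> lborel \<and>
      distr \<Omega> borel Z = M \<and> (\<forall>\<omega>\<in>space \<Omega>. (\<lambda>n. Z_seq n \<omega>) \<longlonglongrightarrow> Z \<omega>)"
    using real_\<kappa> by (intro Skorohod M conv) simp
  then obtain \<Omega> :: "real measure" and Z_seq Z where \<Omega>: "prob_space \<Omega>"
    and Z_seq[measurable]: "\<And>n. Z_seq n \<in> borel_measurable \<Omega>"
    and distr_Z: "\<And>n. distr \<Omega> borel (Z_seq n) = \<kappa> (r n)"
    and Z: "Z \<in> measurable \<Omega> lborel"
    and lim: "\<And>\<omega>. \<omega> \<in> space \<Omega> \<Longrightarrow> (\<lambda>n. Z_seq n \<omega>) \<longlonglongrightarrow> Z \<omega>"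
    unfolding comp_def by blast
  have [measurable]: "Z \<in> borel_measurable \<Omega>" using Z by simp
  have "distr \<Omega> borel (\<lambda>\<omega>. \<Psi> (Z_seq n \<omega>)) = \<nu> (r n)" for n
  proof -
    have "distr \<Omega> borel (\<lambda>\<omega>. \<Psi> (Z_seq n \<omega>)) = distr (distr \<Omega> borel (Z_seq n)) borel \<Psi>"
      by (subst distr_distr) (auto simp: comp_def)
    also have "\<dots> = distr (\<nu> (r n)) borel (\<lambda>x. \<Psi> (\<phi> x))"
      unfolding distr_Z \<kappa>_def by (subst distr_distr) (auto simp: comp_def)
    finally show ?thesis by (simp add: \<Psi>\<phi> distr_id2 sets)
  qed
  moreover have "(\<lambda>n. \<Psi> (Z_seq n \<omega>)) \<longlonglongrightarrow> \<Psi> (Z \<omega>)" if "\<omega> \<in> space \<Omega>" for \<omega>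
    using continuous_on_tendsto_compose[OF cont lim[OF that]] by simp
  ultimately show ?thesis
    using r \<Omega>
    by (intro exI[of _ r] exI[of _ \<Omega>] exI[of _ "\<lambda>n \<omega>. \<Psi> (Z_seq n \<omega>)"] exI[of _ "\<lambda>\<omega>. \<Psi> (Z \<omega>)"]) auto
qed

section \<open>Minimizing a nonnegative interaction energy\<close>

definition pair_energy :: "(real \<Rightarrow> ennreal) \<Rightarrow> 'a::euclidean_space measure \<Rightarrow> ennreal" where
  "pair_energy V \<mu> = (\<integral>\<^sup>+y. \<integral>\<^sup>+x. V (norm (x - y)) \<partial>\<mu> \<partial>\<mu>)"

text \<open>Interaction kernels matter on the half-line only, so measurability is assumed of their even
  extension.\<close>

lemma measurable_radial:
  fixes V :: "real \<Rightarrow> 'b::topological_space"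
  assumes "(\<lambda>r. V \<bar>r\<bar>) \<in> borel_measurable borel" "f \<in> borel_measurable M"
  shows "(\<lambda>x. V (norm (f x))) \<in> borel_measurable M"
proof -
  have "(\<lambda>x. V \<bar>norm (f x)\<bar>) \<in> borel_measurable M"
    by (rule measurable_compose[OF _ assms(1), of "\<lambda>x. norm (f x)"]) (use assms(2) in measurable)
  then show ?thesis by simp
qed

lemma pair_energy_distr:
  fixes X :: "'b \<Rightarrow> 'a::euclidean_space"
  assumes V: "(\<lambda>r. V \<bar>r\<bar>) \<in> borel_measurable borel"
    and M: "sigma_finite_measure M" and X[measurable]: "X \<in> borel_measurable M"
  shows "pair_energy V (distr M borel X) = (\<integral>\<^sup>+\<omega>'. \<integral>\<^sup>+\<omega>. V (norm (X \<omega> - X \<omega>')) \<partial>M \<partial>M)"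
proof -
  interpret sigma_finite_measure M by (rule M)
  have inner: "(\<integral>\<^sup>+x. V (norm (x - y)) \<partial>distr M borel X) = (\<integral>\<^sup>+\<omega>. V (norm (X \<omega> - y)) \<partial>M)" for y
    by (intro nn_integral_distr measurable_radial[OF V]) measurable
  have "(\<lambda>(y, \<omega>). V (norm (X \<omega> - y))) \<in> borel_measurable (borel \<Otimes>\<^sub>M M)"
    unfolding split_beta' by (intro measurable_radial[OF V]) measurable
  then have "(\<lambda>y. \<integral>\<^sup>+\<omega>. V (norm (X \<omega> - y)) \<partial>M) \<in> borel_measurable borel"
    by (rule borel_measurable_nn_integral)
  then show ?thesis
    unfolding pair_energy_def inner by (intro nn_integral_distr X) simp
qed

lemma pair_energy_translate:
  fixes \<mu> :: "'a::euclidean_space measure"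
  assumes V: "(\<lambda>r. V \<bar>r\<bar>) \<in> borel_measurable borel"
    and "sigma_finite_measure \<mu>" and sets: "sets \<mu> = sets borel"
  shows "pair_energy V (distr \<mu> borel (\<lambda>x. x - c)) = pair_energy V \<mu>"
proof -
  note [measurable_cong] = sets
  show ?thesis
    by (subst pair_energy_distr[OF V]) (use assms in \<open>auto simp: pair_energy_def\<close>)
qed

text \<open>Lower semicontinuity of the energy along convergent random variables: the kernel is lower
  semicontinuous at each pair of outcomes, and Fatou's lemma applies first to the inner and then to
  the outer integral.\<close>

lemma pair_energy_distr_le_liminf:
  fixes X :: "nat \<Rightarrow> 'b \<Rightarrow> 'a::euclidean_space"
  assumes V: "(\<lambda>r. V \<bar>r\<bar>) \<in> borel_measurable borel"
    and lsc: "\<And>s r. (\<And>n. 0 \<le> s n) \<Longrightarrow> s \<longlonglongrightarrow> r \<Longrightarrow> V r \<le> liminf (\<lambda>n. V (s n))"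
    and M: "sigma_finite_measure M"
    and X[measurable]: "\<And>n. X n \<in> borel_measurable M" and Y[measurable]: "Y \<in> borel_measurable M"
    and lim: "\<And>\<omega>. \<omega> \<in> space M \<Longrightarrow> (\<lambda>n. X n \<omega>) \<longlonglongrightarrow> Y \<omega>"
  shows "pair_energy V (distr M borel Y) \<le> liminf (\<lambda>n. pair_energy V (distr M borel (X n)))"
proof -
  interpret sigma_finite_measure M by (rule M)
  have "(\<lambda>(\<omega>', \<omega>). V (norm (X n \<omega> - X n \<omega>'))) \<in> borel_measurable (M \<Otimes>\<^sub>M M)" for n
    unfolding split_beta' by (intro measurable_radial[OF V]) measurable
  then have meas: "(\<lambda>\<omega>'. \<integral>\<^sup>+\<omega>. V (norm (X n \<omega> - X n \<omega>')) \<partial>M) \<in> borel_measurable M" for n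
    by (rule borel_measurable_nn_integral)
  have "pair_energy V (distr M borel Y) = (\<integral>\<^sup>+\<omega>'. \<integral>\<^sup>+\<omega>. V (norm (Y \<omega> - Y \<omega>')) \<partial>M \<partial>M)"
    by (rule pair_energy_distr[OF V M Y])
  also have "\<dots> \<le> (\<integral>\<^sup>+\<omega>'. \<integral>\<^sup>+\<omega>. liminf (\<lambda>n. V (norm (X n \<omega> - X n \<omega>'))) \<partial>M \<partial>M)"
    by (intro nn_integral_mono lsc tendsto_norm tendsto_diff lim) auto
  also have "\<dots> \<le> (\<integral>\<^sup>+\<omega>'. liminf (\<lambda>n. \<integral>\<^sup>+\<omega>. V (norm (X n \<omega> - X n \<omega>')) \<partial>M) \<partial>M)"
    by (intro nn_integral_mono nn_integral_liminf measurable_radial[OF V]) measurable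
  also have "\<dots> \<le> liminf (\<lambda>n. \<integral>\<^sup>+\<omega>'. \<integral>\<^sup>+\<omega>. V (norm (X n \<omega> - X n \<omega>')) \<partial>M \<partial>M)"
    by (intro nn_integral_liminf meas)
  finally show ?thesis by (simp add: pair_energy_distr[OF V M X])
qed

text \<open>Markov's inequality: once \<open>V\<close> exceeds \<open>K\<close> outside a ball, the mass outside is at most \<open>B / K\<close>, the
  same for all members of the sequence.\<close>

lemma tight_if_coercive_moment_bounded:
  fixes \<nu> :: "nat \<Rightarrow> 'a::euclidean_space measure"
  assumes prob: "\<And>n. prob_space (\<nu> n)" and sets: "\<And>n. sets (\<nu> n) = sets borel"
    and coercive: "\<And>K::real. eventually (\<lambda>r. ennreal K < V r) at_top"
    and bound: "\<And>n. (\<integral>\<^sup>+x. V (norm x) \<partial>\<nu> n) \<le> B" and B: "B < top" and "\<epsilon> > (0::real)"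
  shows "\<exists>R. \<forall>n. measure (\<nu> n) {x. R \<le> norm x} < \<epsilon>"
proof -
  note [measurable_cong] = sets
  obtain b where b: "B = ennreal b" "b \<ge> 0" using B by (cases B) auto
  \<comment> \<open>The summand 1 makes the final inequality strict and covers the case of a zero bound.\<close>
  define K where "K = (b + 1) / \<epsilon>"
  have K: "K > 0" using b \<open>\<epsilon> > 0\<close> by (simp add: K_def)
  obtain R where R: "\<And>r. r \<ge> R \<Longrightarrow> ennreal K < V r"
    using coercive[of K] by (auto simp: eventually_at_top_linorder)
  have "measure (\<nu> n) {x. R \<le> norm x} < \<epsilon>" for n
  proof -
    interpret prob_space "\<nu> n" by (rule prob)
    have "ennreal (K * measure (\<nu> n) {x. R \<le> norm x}) = (\<integral>\<^sup>+x. ennreal K * indicator {x. R \<le> norm x} x \<partial>\<nu> n)"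
      using K by (subst nn_integral_cmult_indicator) (auto simp: emeasure_eq_measure ennreal_mult)
    also have "\<dots> \<le> (\<integral>\<^sup>+x. V (norm x) \<partial>\<nu> n)"
      by (intro nn_integral_mono) (auto simp: indicator_def less_imp_le[OF R])
    also have "\<dots> \<le> ennreal b" using bound b by simp
    finally have "K * measure (\<nu> n) {x. R \<le> norm x} \<le> b" using b by simp
    also have "\<dots> < K * \<epsilon>" using \<open>\<epsilon> > 0\<close> by (simp add: K_def)
    finally show ?thesis using K by simp
  qed
  then show ?thesis by blast
qed

text \<open>The energy is the average over \<open>y\<close> of the integrals of \<open>V (norm (x - y))\<close> in \<open>x\<close>, so some \<open>y\<close> has such an
  integral at most \<open>B\<close>; translating that \<open>y\<close> to the origin leaves the energy unchanged. Without such
  a normalization a minimizing sequence could drift to infinity.\<close>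

lemma pair_energy_translate_with_moment_bound:
  fixes \<mu> :: "'a::euclidean_space measure"
  assumes V: "(\<lambda>r. V \<bar>r\<bar>) \<in> borel_measurable borel"
    and prob: "prob_space \<mu>" and sets: "sets \<mu> = sets borel"
    and bound: "pair_energy V \<mu> < B"
  obtains \<nu> :: "'a measure" where "prob_space \<nu>" "sets \<nu> = sets borel" "pair_energy V \<nu> = pair_energy V \<mu>"
    "(\<integral>\<^sup>+x. V (norm x) \<partial>\<nu>) \<le> B"
proof -
  note [measurable_cong] = sets
  interpret prob_space \<mu> by (rule prob)
  have "\<exists>y. (\<integral>\<^sup>+x. V (norm (x - y)) \<partial>\<mu>) \<le> B"
  proof (rule ccontr)
    assume "\<not> ?thesis"
    then have "(\<integral>\<^sup>+y. B \<partial>\<mu>) \<le> pair_energy V \<mu>"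
      unfolding pair_energy_def by (intro nn_integral_mono) (metis less_imp_le not_le)
    then show False using bound by (simp add: emeasure_space_1 not_le[symmetric])
  qed
  then obtain y where y: "(\<integral>\<^sup>+x. V (norm (x - y)) \<partial>\<mu>) \<le> B" by blast
  show thesis
  proof (rule that[of "distr \<mu> borel (\<lambda>x. x - y)"])
    show "prob_space (distr \<mu> borel (\<lambda>x. x - y))" by (intro prob_space_distr) measurable
    show "pair_energy V (distr \<mu> borel (\<lambda>x. x - y)) = pair_energy V \<mu>"
      by (intro pair_energy_translate V sets) unfold_locales
    show "(\<integral>\<^sup>+x. V (norm x) \<partial>distr \<mu> borel (\<lambda>x. x - y)) \<le> B"
      using y by (subst nn_integral_distr) (auto intro!: measurable_radial[OF V])
  qed simp
qed

lemma pair_energy_minimizer_exists: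
  assumes V: "(\<lambda>r. V \<bar>r\<bar>) \<in> borel_measurable borel"
    and lsc: "\<And>s r. (\<And>n. 0 \<le> s n) \<Longrightarrow> s \<longlonglongrightarrow> r \<Longrightarrow> V r \<le> liminf (\<lambda>n. V (s n))"
    and coercive: "\<And>K::real. eventually (\<lambda>r. ennreal K < V r) at_top"
  shows "\<exists>\<mu>\<^sub>0\<in>(borel_prob_measures :: 'a::euclidean_space measure set).
           \<forall>\<mu>\<in>(borel_prob_measures :: 'a measure set). pair_energy V \<mu>\<^sub>0 \<le> pair_energy V \<mu>"
proof -
  let ?P = "borel_prob_measures :: 'a measure set"
  define m where "m = Inf (pair_energy V ` ?P)"
  have lower: "m \<le> pair_energy V \<mu>" if "\<mu> \<in> ?P" for \<mu>
    unfolding m_def using that by (rule INF_lower)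
  have ne: "return borel 0 \<in> ?P"
    by (auto simp: borel_prob_measures_def intro!: prob_space_return)
  show ?thesis
  proof (cases "m = top")
    case True
    then have "pair_energy V \<mu> = top" if "\<mu> \<in> ?P" for \<mu>
      using lower[OF that] by (simp add: top_unique)
    then show ?thesis using ne by auto
  next
    case False
    \<comment> \<open>The uniform bound on the integral of the kernel uses that the tolerance never exceeds 1.\<close>
    have "\<exists>\<nu>. prob_space \<nu> \<and> sets \<nu> = sets borel \<and> pair_energy V \<nu> \<le> m + ennreal (1 / Suc n) \<and>
             (\<integral>\<^sup>+x. V (norm (x::'a)) \<partial>\<nu>) \<le> m + 1" for n
    proof -
      have "m < m + ennreal (1 / Suc n)"
        using False by (cases m) (auto simp: ennreal_plus[symmetric] ennreal_less_iff simp del: ennreal_plus)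
      then obtain \<mu> :: "'a measure" where \<mu>: "prob_space \<mu>" "sets \<mu> = sets borel"
          "pair_energy V \<mu> < m + ennreal (1 / Suc n)"
        unfolding m_def INF_less_iff by (auto simp: borel_prob_measures_def)
      have "ennreal (1 / Suc n) \<le> 1" by simp
      then have "pair_energy V \<mu> < m + 1" using \<mu>(3) by (meson add_left_mono order_less_le_trans)
      from pair_energy_translate_with_moment_bound[OF V \<mu>(1,2) this]
      obtain \<nu> :: "'a measure" where "prob_space \<nu>" "sets \<nu> = sets borel"
        "pair_energy V \<nu> = pair_energy V \<mu>" "(\<integral>\<^sup>+x. V (norm x) \<partial>\<nu>) \<le> m + 1" .
      then show ?thesis using \<mu>(3) by (intro exI[of _ \<nu>]) (simp add: less_imp_le)
    qed
    then obtain \<nu> :: "nat \<Rightarrow> 'a measure" where \<nu>: "\<And>n. prob_space (\<nu> n)" "\<And>n. sets (\<nu> n) = sets borel"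
      and energy: "\<And>n. pair_energy V (\<nu> n) \<le> m + ennreal (1 / Suc n)"
      and moment: "\<And>n. (\<integral>\<^sup>+x. V (norm x) \<partial>\<nu> n) \<le> m + 1" by metis
    have finite: "m + 1 < top" using False by (simp add: less_top)
    have tight: "\<forall>\<epsilon>::real>0. \<exists>R. \<forall>n. measure (\<nu> n) {x. R \<le> norm x} < \<epsilon>"
      by (intro allI impI tight_if_coercive_moment_bounded[where \<nu> = \<nu> and V = V, OF \<nu> coercive moment finite])
    obtain r and \<Omega> :: "real measure" and X :: "nat \<Rightarrow> real \<Rightarrow> 'a" and Y
      where r: "strict_mono r" and \<Omega>: "prob_space \<Omega>"
      and X: "\<And>n. X n \<in> borel_measurable \<Omega>" and Y: "Y \<in> borel_measurable \<Omega>"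
      and distr: "\<And>n. distr \<Omega> borel (X n) = \<nu> (r n)"
      and lim: "\<And>\<omega>. \<omega> \<in> space \<Omega> \<Longrightarrow> (\<lambda>n. X n \<omega>) \<longlonglongrightarrow> Y \<omega>"
      using tight_sequence_representation[where \<nu> = \<nu>, OF \<nu> tight] by blast
    interpret \<Omega>: prob_space \<Omega> by (rule \<Omega>)
    have "pair_energy V (distr \<Omega> borel Y) \<le> liminf (\<lambda>n. pair_energy V (\<nu> (r n)))"
      using pair_energy_distr_le_liminf[where V = V and X = X,
          OF V lsc \<Omega>.sigma_finite_measure_axioms X Y lim]
      by (simp only: distr)
    also have "\<dots> \<le> liminf (\<lambda>n. m + ennreal (1 / Suc n))"
    proof (intro Liminf_mono always_eventually allI)
      fix n
      have "n \<le> r n" using r by (rule strict_mono_imp_increasing)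
      then have "ennreal (1 / Suc (r n)) \<le> ennreal (1 / Suc n)"
        by (intro ennreal_leI) (simp add: frac_le)
      then show "pair_energy V (\<nu> (r n)) \<le> m + ennreal (1 / Suc n)"
        using energy[of "r n"] by (meson add_left_mono order_trans)
    qed
    also have "\<dots> = m"
    proof (intro lim_imp_Liminf)
      have "(\<lambda>n. m + ennreal (1 / Suc n)) \<longlonglongrightarrow> m + ennreal 0"
        using LIMSEQ_inverse_real_of_nat by (intro tendsto_add tendsto_const tendsto_ennrealI) (simp add: inverse_eq_divide)
      then show "(\<lambda>n. m + ennreal (1 / Suc n)) \<longlonglongrightarrow> m" by simp
    qed simp
    finally have "pair_energy V (distr \<Omega> borel Y) \<le> m" .
    moreover have "distr \<Omega> borel Y \<in> ?P"
      using \<Omega>.prob_space_distr[OF Y] by (simp add: borel_prob_measures_def)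
    ultimately show ?thesis using lower order_trans by blast
  qed
qed

section \<open>Reduction to nonnegative interactions\<close>

text \<open>At \<open>r\<close> itself the inequality holds by assumption, so the punctured neighbourhoods in the definition
  may be replaced by full ones.\<close>

lemma lower_semicontinuous_on_imp_eventually_greater:
  assumes "lower_semicontinuous_on S W" "r \<in> S" "c < W r"
  shows "eventually (\<lambda>s. s \<in> S \<longrightarrow> c < W s) (nhds r)"
proof -
  have "c < Liminf (at r within S) W"
    using assms unfolding lower_semicontinuous_on_def by (meson order_less_le_trans)
  then have "eventually (\<lambda>s. c < W s) (at r within S)" by (rule less_LiminfD)
  then show ?thesis
    unfolding eventually_at_filter by (rule eventually_mono) (use assms(3) in auto)
qed

lemma lower_semicontinuous_on_le_liminf:
  assumes lsc: "lower_semicontinuous_on S W" and "r \<in> S" "\<And>n. s n \<in> S" "s \<longlonglongrightarrow> r"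
  shows "W r \<le> liminf (\<lambda>n. W (s n))"
  unfolding le_Liminf_iff
proof (intro allI impI)
  fix c assume "c < W r"
  from lower_semicontinuous_on_imp_eventually_greater[OF lsc \<open>r \<in> S\<close> this]
  have "eventually (\<lambda>n. s n \<in> S \<longrightarrow> c < W (s n)) sequentially"
    using \<open>s \<longlonglongrightarrow> r\<close> by (rule eventually_compose_filterlim)
  then show "eventually (\<lambda>n. c < W (s n)) sequentially" using assms(3) by simp
qed

lemma lower_semicontinuous_imp_borel_radial:
  assumes lsc: "lower_semicontinuous_on {0..} W"
  shows "(\<lambda>r::real. W \<bar>r\<bar>) \<in> borel_measurable borel"
proof (rule borel_measurableI_greater)
  fix c
  have "open {r. c < W \<bar>r\<bar>}"
  proof (rule iffD2[OF open_subopen], safe)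
    fix r assume "c < W \<bar>r\<bar>"
    then have ev: "eventually (\<lambda>s. s \<in> {0..} \<longrightarrow> c < W s) (nhds \<bar>r\<bar>)"
      by (intro lower_semicontinuous_on_imp_eventually_greater[OF lsc]) auto
    have "filterlim (\<lambda>s::real. \<bar>s\<bar>) (nhds \<bar>r\<bar>) (nhds r)"
      by (intro tendsto_rabs filterlim_ident)
    from eventually_compose_filterlim[OF ev this]
    have "eventually (\<lambda>s. c < W \<bar>s\<bar>) (nhds r)" by simp
    then show "\<exists>T. open T \<and> r \<in> T \<and> T \<subseteq> {r. c < W \<bar>r\<bar>}"
      unfolding eventually_nhds by blast
  qed
  then show "{r \<in> space borel. c < W \<bar>r\<bar>} \<in> sets borel" by simp
qed

text \<open>If \<open>W\<close> took arbitrarily negative values, it would do so on a bounded interval by coercivity, and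
  at an accumulation point lower semicontinuity would force the value \<open>-\<infinity>\<close>.\<close>

lemma lower_semicontinuous_coercive_bounded_below:
  fixes W :: "real \<Rightarrow> ereal"
  assumes not_minf: "\<And>r. r \<ge> 0 \<Longrightarrow> W r \<noteq> -\<infinity>"
    and lsc: "lower_semicontinuous_on {0..} W" and coercive: "(W \<longlongrightarrow> \<infinity>) at_top"
  obtains C :: real where "C \<ge> 0" "\<And>r. r \<ge> 0 \<Longrightarrow> - ereal C \<le> W r"
proof -
  have "\<exists>n::nat. \<forall>r\<ge>0. - ereal n \<le> W r"
  proof (rule ccontr)
    assume "\<not> ?thesis"
    then have "\<forall>n::nat. \<exists>r. r \<ge> 0 \<and> W r < - ereal n" by (simp add: not_le)
    then obtain s :: "nat \<Rightarrow> real" where s: "\<And>n. s n \<ge> 0" "\<And>n. W (s n) < - ereal n" by metis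
    have "eventually (\<lambda>r. 0 < W r) at_top" using coercive by (rule order_tendstoD) simp
    then obtain R where R: "\<And>r. r \<ge> R \<Longrightarrow> 0 < W r" by (auto simp: eventually_at_top_linorder)
    have "s n \<in> {0..R}" for n
    proof -
      have "W (s n) < 0" using s(2)[of n] by (rule order_less_le_trans) simp
      then show ?thesis using R[of "s n"] s(1)[of n] by (cases "s n \<le> R") (auto dest: less_asym)
    qed
    then obtain r k where r: "r \<in> {0..R}" and k: "strict_mono k" and lim: "(s \<circ> k) \<longlonglongrightarrow> r"
      using seq_compactE[OF compact_imp_seq_compact[OF compact_Icc[of 0 R]], of s] by blast
    have le: "W r \<le> liminf (\<lambda>n. W ((s \<circ> k) n))"
      by (rule lower_semicontinuous_on_le_liminf[OF lsc _ _ lim]) (use r s(1) in auto)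
    have "W r \<le> - ereal N" for N :: nat
    proof -
      have "liminf (\<lambda>n. W ((s \<circ> k) n)) \<le> liminf (\<lambda>n. - ereal N)"
      proof (intro Liminf_mono)
        show "eventually (\<lambda>n. W ((s \<circ> k) n) \<le> - ereal N) sequentially"
          using eventually_ge_at_top[of N]
        proof eventually_elim
          case (elim n)
          then have "N \<le> k n" using strict_mono_imp_increasing[OF k, of n] by simp
          then have "- ereal (k n) \<le> - ereal N" by simp
          with less_imp_le[OF s(2)[of "k n"]] have "W (s (k n)) \<le> - ereal N" by (rule order_trans)
          then show ?case by simp
        qed
      qed
      then show ?thesis using le by (simp add: Liminf_const)
    qed
    then have "W r = -\<infinity>"
    proof (cases "W r")
      case (real x)
      then show ?thesis using \<open>\<And>N. W r \<le> - ereal (real N)\<close>[of "nat \<lceil>\<bar>x\<bar> + 1\<rceil>"] by simp linarith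
    next
      case PInf
      then show ?thesis using \<open>\<And>N. W r \<le> - ereal (real N)\<close>[of 0] by simp
    qed simp
    then show False using not_minf r by auto
  qed
  then obtain n :: nat where "\<forall>r\<ge>0. - ereal n \<le> W r" by blast
  then show thesis by (intro that[of "real n"]) auto
qed

text \<open>Adding \<open>C\<close> makes the integrand nonnegative, hence the integral a single nonnegative one. The
  negative part is at most \<open>C\<close>, so its integral is finite on a probability space and may be cancelled.\<close>

lemma ereal_integral_add_const:
  assumes M: "prob_space M" and f[measurable]: "f \<in> borel_measurable M"
    and C: "C \<ge> 0" and lower: "\<And>x. - ereal C \<le> f x"
  shows "ereal_integral M f + ereal C = enn2ereal (\<integral>\<^sup>+x. e2ennreal (f x + ereal C) \<partial>M)"
proof -
  interpret prob_space M by (rule M)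
  let ?P = "\<integral>\<^sup>+x. e2ennreal (f x) \<partial>M" and ?N = "\<integral>\<^sup>+x. e2ennreal (- f x) \<partial>M"
    and ?Q = "\<integral>\<^sup>+x. e2ennreal (f x + ereal C) \<partial>M"
  have pointwise: "e2ennreal (f x + ereal C) + e2ennreal (- f x) = e2ennreal (f x) + ennreal C" for x
  proof (cases "f x")
    case (real y)
    then have "- C \<le> y" using lower[of x] by simp
    then show ?thesis using real C
      by (cases "y \<ge> 0") (auto simp: ennreal_neg ennreal_plus[symmetric] simp del: ennreal_plus)
  qed (use lower[of x] in auto)
  have "?Q + ?N = (\<integral>\<^sup>+x. e2ennreal (f x) + ennreal C \<partial>M)"
    by (subst nn_integral_add[symmetric]) (auto simp: pointwise)
  also have "\<dots> = ?P + ennreal C"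
    by (subst nn_integral_add) (auto simp: emeasure_space_1)
  finally have sum: "enn2ereal ?Q + enn2ereal ?N = enn2ereal ?P + ereal C"
    using C by (metis enn2ereal_ennreal plus_ennreal.rep_eq)
  have "?N \<le> (\<integral>\<^sup>+x. ennreal C \<partial>M)"
  proof (intro nn_integral_mono)
    fix x
    have "- f x \<le> ereal C" using lower[of x] by (simp add: ereal_uminus_le_reorder)
    then show "e2ennreal (- f x) \<le> ennreal C" using e2ennreal_mono by fastforce
  qed
  then have "?N \<le> ennreal C" by (simp add: emeasure_space_1)
  then obtain n where n: "enn2ereal ?N = ereal n"
    by (cases ?N) (auto simp: top_unique)
  show ?thesis
    using sum unfolding ereal_integral_def n
    by (cases "enn2ereal ?Q"; cases "enn2ereal ?P") auto
qed

text \<open>The constant is added at both levels: first to the inner integral, which is then itself bounded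
  below by \<open>-C\<close> as a function of \<open>y\<close>, and then to the outer one.\<close>

lemma interaction_energy_add_const:
  fixes \<mu> :: "'a::euclidean_space measure"
  assumes W: "(\<lambda>r. W \<bar>r\<bar>) \<in> borel_measurable borel"
    and C: "C \<ge> 0" and lower: "\<And>r. r \<ge> 0 \<Longrightarrow> - ereal C \<le> W r"
    and \<mu>: "\<mu> \<in> borel_prob_measures"
  shows "interaction_energy W \<mu> + ereal C = enn2ereal (pair_energy (\<lambda>r. e2ennreal (W r + ereal C)) \<mu>)"
proof -
  have prob: "prob_space \<mu>" and sets[measurable_cong]: "sets \<mu> = sets borel"
    using \<mu> by (auto simp: borel_prob_measures_def)
  interpret prob_space \<mu> by (rule prob)
  let ?V = "\<lambda>r. e2ennreal (W r + ereal C)"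
  define h where "h y = (\<integral>\<^sup>+x. ?V (norm (x - y)) \<partial>\<mu>)" for y
  have V: "(\<lambda>r. ?V \<bar>r\<bar>) \<in> borel_measurable borel"
    using W by measurable
  have "(\<lambda>(y, x). ?V (norm (x - y))) \<in> borel_measurable (borel \<Otimes>\<^sub>M \<mu>)"
    unfolding split_beta' by (intro measurable_radial[where V = ?V, OF V]) measurable
  then have [measurable]: "h \<in> borel_measurable borel"
    unfolding h_def by (rule borel_measurable_nn_integral)
  have inner: "ereal_integral \<mu> (\<lambda>x. W (norm (x - y))) = enn2ereal (h y) - ereal C" for y
  proof -
    have "ereal_integral \<mu> (\<lambda>x. W (norm (x - y))) + ereal C = enn2ereal (h y)"
      unfolding h_def
      by (intro ereal_integral_add_const prob measurable_radial[OF W] C lower) auto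
    then show ?thesis by (cases "ereal_integral \<mu> (\<lambda>x. W (norm (x - y)))"; cases "enn2ereal (h y)") auto
  qed
  have "interaction_energy W \<mu> + ereal C = enn2ereal (\<integral>\<^sup>+y. e2ennreal (enn2ereal (h y) - ereal C + ereal C) \<partial>\<mu>)"
    unfolding interaction_energy_def inner
  proof (intro ereal_integral_add_const prob C)
    show "- ereal C \<le> enn2ereal (h y) - ereal C" for y
      using enn2ereal_nonneg[of "h y"] by (cases "enn2ereal (h y)") auto
  qed measurable
  moreover have "enn2ereal (h y) - ereal C + ereal C = enn2ereal (h y)" for y
    by (cases "enn2ereal (h y)") auto
  ultimately show ?thesis by (simp add: pair_energy_def h_def)
qed

theorem theorem3p1:
  fixes W :: "real \<Rightarrow> ereal"
  assumes "\<And>r. r \<ge> 0 \<Longrightarrow> W r \<noteq> -\<infinity>"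
    and "lower_semicontinuous_on {0..} W"
    and "locally_integrable (\<lambda>x :: real ^ 'n. W (norm x))"
    and "(W \<longlongrightarrow> \<infinity>) at_top"
  shows "\<exists>\<mu>\<^sub>0 \<in> (borel_prob_measures :: (real ^ 'n) measure set).
           \<forall>\<mu> \<in> (borel_prob_measures :: (real ^ 'n) measure set).
             interaction_energy W \<mu>\<^sub>0 \<le> interaction_energy W \<mu>"
proof -
  obtain C :: real where C: "C \<ge> 0" "\<And>r. r \<ge> 0 \<Longrightarrow> - ereal C \<le> W r"
    using lower_semicontinuous_coercive_bounded_below[OF assms(1,2,4)] by blast
  have W: "(\<lambda>r. W \<bar>r\<bar>) \<in> borel_measurable borel"
    by (rule lower_semicontinuous_imp_borel_radial[OF assms(2)])
  define V where "V r = e2ennreal (W r + ereal C)" for r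
  have V_meas: "(\<lambda>r. V \<bar>r\<bar>) \<in> borel_measurable borel"
    unfolding V_def using W by measurable
  have V_lsc: "V r \<le> liminf (\<lambda>n. V (s n))" if "\<And>n. 0 \<le> s n" "s \<longlonglongrightarrow> r" for s r
    unfolding le_Liminf_iff
  proof (intro allI impI)
    fix c assume c: "c < V r"
    have "0 \<le> r" using that by (intro LIMSEQ_le_const) auto
    obtain k where k: "c = ennreal k" "0 \<le> k" using c by (cases c) auto
    \<comment> \<open>Strict inequalities for the shifted kernel translate back to the original one because the shift makes it nonnegative.\<close>
    have iff: "c < V q \<longleftrightarrow> ereal (k - C) < W q" if "0 \<le> q" for q
      using C(2)[OF that] k by (cases "W q") (auto simp: V_def ennreal_less_iff)
    have "W r \<le> liminf (\<lambda>n. W (s n))"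
      using that \<open>0 \<le> r\<close> by (intro lower_semicontinuous_on_le_liminf[OF assms(2)]) auto
    then have "ereal (k - C) < liminf (\<lambda>n. W (s n))"
      using c iff \<open>0 \<le> r\<close> by (meson order_less_le_trans)
    from less_LiminfD[OF this] show "eventually (\<lambda>n. c < V (s n)) sequentially"
      using iff that(1) by simp
  qed
  have V_coercive: "eventually (\<lambda>r. ennreal K < V r) at_top" for K
  proof -
    have "eventually (\<lambda>r. ereal \<bar>K\<bar> < W r) at_top"
      using assms(4) by (rule order_tendstoD) simp
    then show ?thesis
    proof eventually_elim
      case (elim r)
      have "ereal \<bar>K\<bar> < W r + ereal C"
        using elim C(1) by (cases "W r") auto
      moreover have "ennreal K \<le> ennreal \<bar>K\<bar>" by (rule ennreal_leI) simp
      ultimately show ?case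
        unfolding V_def by (cases "W r + ereal C") (auto simp: ennreal_lessI)
    qed
  qed
  obtain \<mu>\<^sub>0 :: "(real ^ 'n) measure" where \<mu>\<^sub>0: "\<mu>\<^sub>0 \<in> borel_prob_measures"
    and min: "\<And>\<mu> :: (real ^ 'n) measure. \<mu> \<in> borel_prob_measures \<Longrightarrow> pair_energy V \<mu>\<^sub>0 \<le> pair_energy V \<mu>"
    using pair_energy_minimizer_exists[where V = V, OF V_meas V_lsc V_coercive] by blast
  have "interaction_energy W \<mu>\<^sub>0 \<le> interaction_energy W \<mu>" if \<mu>: "\<mu> \<in> borel_prob_measures" for \<mu> :: "(real ^ 'n) measure"
  proof -
    have shift: "interaction_energy W \<mu> + ereal C = enn2ereal (pair_energy V \<mu>)"
      if "\<mu> \<in> borel_prob_measures" for \<mu> :: "(real ^ 'n) measure"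
      unfolding V_def by (rule interaction_energy_add_const[OF W C that])
    have "interaction_energy W \<mu>\<^sub>0 + ereal C \<le> interaction_energy W \<mu> + ereal C"
      using min[OF \<mu>] by (simp add: shift \<mu> \<mu>\<^sub>0 less_eq_ennreal.rep_eq)
    then show ?thesis
      by (cases "interaction_energy W \<mu>\<^sub>0"; cases "interaction_energy W \<mu>") auto
  qed
  then show ?thesis using \<mu>\<^sub>0 by blast
qed

end
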